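(* Let $\mathscr{C}=(C_i)_{i\in[n]}$ be a finite collection of closed convex subsets of $\mathbb{R}^d$, where $[n]=\{0,\dots,n\}$, and let $X=\bigcup_{i}C_i$. For each simplex $J\in\operatorname{Nrv}(\mathscr{C})$ choose a point $p_J\in C_J=\bigcap_{j\in J}C_j$, and let $\Gamma\colon|\operatorname{Sd}\operatorname{Nrv}(\mathscr{C})|\to X$ be the unique map that sends each vertex $J$ of $\operatorname{Sd}\operatorname{Nrv}(\mathscr{C})$ to $p_J$ and is affine linear on each simplex of the barycentric subdivision. Then $\Gamma$ is a homotopy equivalence. In particular, $|\operatorname{Nrv}(\mathscr{C})|$ is homotopy equivalent to $X$.
   Context: The nerve $\operatorname{Nrv}(\mathscr{C})$ is the abstract simplicial complex whose simplices are the finite subsets $J\subseteq[n]$ with $C_J\neq\emptyset$ (simplices are understood to be non-empty). $\operatorname{Sd}K$ denotes the barycentric subdivision of a simplicial complex $K$: its vertices are the simplices of $K$ and its simplices are the finite non-empty chains $\tau_0\subset\dots\subset\tau_m$ of simplices of $K$. $|\cdot|$ denotes geometric realization. The map $\Gamma$ is well-defined with values in $X$ by convexity of the $C_i$. *)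

theory Defs
  imports "HOL-Analysis.Analysis"
begin

definition nerve :: "'i set \<Rightarrow> ('i \<Rightarrow> 'a set) \<Rightarrow> 'i set set" where
  "nerve I C = {J. J \<subseteq> I \<and> finite J \<and> J \<noteq> {} \<and> (\<Inter>j\<in>J. C j) \<noteq> {}}"

definition barycentric_subdivision :: "'v set set \<Rightarrow> 'v set set set" where
  "barycentric_subdivision K = {c. finite c \<and> c \<noteq> {} \<and> subset.chain K c}"

text \<open>
  Points of the geometric realization are families of barycentric coordinates, indexed by all
  elements of the vertex type and vanishing outside some simplex. The realization carries the
  topology coherent with its closed simplices.
\<close>

definition closed_simplex :: "'v set \<Rightarrow> ('v \<Rightarrow> real) set" where
  "closed_simplex \<sigma> = {x. (\<forall>v. 0 \<le> x v) \<and> (\<forall>v. v \<notin> \<sigma> \<longrightarrow> x v = 0) \<and> (\<Sum>v\<in>\<sigma>. x v) = 1}"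

definition realization_openin :: "'v set set \<Rightarrow> ('v \<Rightarrow> real) set \<Rightarrow> bool" where
  "realization_openin K U \<longleftrightarrow> U \<subseteq> (\<Union>\<sigma>\<in>K. closed_simplex \<sigma>) \<and>
     (\<forall>\<sigma>\<in>K. openin (subtopology (powertop_real UNIV) (closed_simplex \<sigma>)) (U \<inter> closed_simplex \<sigma>))"

definition geometric_realization :: "'v set set \<Rightarrow> ('v \<Rightarrow> real) topology" where
  "geometric_realization K = topology (realization_openin K)"

lemma istopology_realization_openin: "istopology (realization_openin K)"
proof -
  have "realization_openin K (S \<inter> T)"
    if S: "realization_openin K S" and T: "realization_openin K T" for S T
    unfolding realization_openin_def
  proof (intro conjI ballI)
    show "S \<inter> T \<subseteq> (\<Union>\<sigma>\<in>K. closed_simplex \<sigma>)"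
      using S by (auto simp: realization_openin_def)
    show "openin (subtopology (powertop_real UNIV) (closed_simplex \<sigma>)) (S \<inter> T \<inter> closed_simplex \<sigma>)"
      if "\<sigma> \<in> K" for \<sigma>
      using S T that openin_Int[of _ "S \<inter> closed_simplex \<sigma>" "T \<inter> closed_simplex \<sigma>"]
      by (simp add: realization_openin_def Int_ac)
  qed
  moreover have "realization_openin K (\<Union>\<U>)" if "\<forall>U\<in>\<U>. realization_openin K U" for \<U>
    unfolding realization_openin_def
  proof (intro conjI ballI)
    show "\<Union>\<U> \<subseteq> (\<Union>\<sigma>\<in>K. closed_simplex \<sigma>)"
      using that by (auto simp: realization_openin_def)
    show "openin (subtopology (powertop_real UNIV) (closed_simplex \<sigma>)) (\<Union>\<U> \<inter> closed_simplex \<sigma>)"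
      if "\<sigma> \<in> K" for \<sigma>
    proof -
      have "openin (subtopology (powertop_real UNIV) (closed_simplex \<sigma>))
              (\<Union>U\<in>\<U>. U \<inter> closed_simplex \<sigma>)"
        using \<open>\<forall>U\<in>\<U>. realization_openin K U\<close> that
        by (intro openin_Union) (auto simp: realization_openin_def)
      then show ?thesis by (simp only: Int_Union2)
    qed
  qed
  ultimately show ?thesis
    unfolding istopology_def by blast
qed

lemma openin_geometric_realization:
  "openin (geometric_realization K) U \<longleftrightarrow> realization_openin K U"
  by (simp add: geometric_realization_def istopology_realization_openin)

lemma topspace_geometric_realization:
  "topspace (geometric_realization K) = (\<Union>\<sigma>\<in>K. closed_simplex \<sigma>)"
proof
  show "topspace (geometric_realization K) \<subseteq> (\<Union>\<sigma>\<in>K. closed_simplex \<sigma>)"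
    unfolding topspace_def openin_geometric_realization realization_openin_def by blast
  have "openin (subtopology (powertop_real UNIV) F) F" for F :: "('a \<Rightarrow> real) set"
    using openin_topspace[of "subtopology (powertop_real UNIV) F"]
    by (simp add: topspace_product_topology)
  moreover have "(\<Union>\<sigma>\<in>K. closed_simplex \<sigma>) \<inter> closed_simplex \<tau> = closed_simplex \<tau>" if "\<tau> \<in> K" for \<tau>
    using that by blast
  ultimately have "openin (geometric_realization K) (\<Union>\<sigma>\<in>K. closed_simplex \<sigma>)"
    unfolding openin_geometric_realization realization_openin_def by simp
  then show "(\<Union>\<sigma>\<in>K. closed_simplex \<sigma>) \<subseteq> topspace (geometric_realization K)"
    by (rule openin_subset)
qed

definition realization_vertex :: "'v \<Rightarrow> ('v \<Rightarrow> real)" where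
  "realization_vertex v = (\<lambda>w. if w = v then 1 else 0)"

definition affine_on_simplices :: "'v set set \<Rightarrow> (('v \<Rightarrow> real) \<Rightarrow> 'b::real_vector) \<Rightarrow> bool" where
  "affine_on_simplices K f \<longleftrightarrow>
     (\<forall>\<sigma>\<in>K. \<forall>x\<in>closed_simplex \<sigma>. \<forall>y\<in>closed_simplex \<sigma>. \<forall>t\<in>{0..1}.
        f (\<lambda>v. (1 - t) * x v + t * y v) = (1 - t) *\<^sub>R f x + t *\<^sub>R f y)"

definition homotopy_equivalence :: "'a topology \<Rightarrow> 'b topology \<Rightarrow> ('a \<Rightarrow> 'b) \<Rightarrow> bool" where
  "homotopy_equivalence X Y f \<longleftrightarrow> continuous_map X Y f \<and>
     (\<exists>g. continuous_map Y X g \<and>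
          homotopic_with (\<lambda>x. True) X X (g \<circ> f) id \<and>
          homotopic_with (\<lambda>x. True) Y Y (f \<circ> g) id)"

text \<open>Prescribed values on the vertices have exactly one extension that is affine on simplices.\<close>

lemma affine_on_simplices_exists:
  fixes p :: "'v \<Rightarrow> 'b::real_vector"
  assumes "\<And>\<sigma>. \<sigma> \<in> K \<Longrightarrow> finite \<sigma>"
  obtains f where "affine_on_simplices K f" "\<And>v. f (realization_vertex v) = p v"
proof
  define f where "f x = (\<Sum>v | x v \<noteq> 0. x v *\<^sub>R p v)" for x :: "'v \<Rightarrow> real"
  have f: "f x = (\<Sum>v\<in>\<sigma>. x v *\<^sub>R p v)" if "finite \<sigma>" "\<And>v. v \<notin> \<sigma> \<Longrightarrow> x v = 0" for x \<sigma>
    unfolding f_def using that by (intro sum.mono_neutral_left) auto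
  show "affine_on_simplices K f"
    unfolding affine_on_simplices_def
  proof (intro ballI)
    fix \<sigma> x y and t :: real
    assume "\<sigma> \<in> K" "x \<in> closed_simplex \<sigma>" "y \<in> closed_simplex \<sigma>"
    then show "f (\<lambda>v. (1 - t) * x v + t * y v) = (1 - t) *\<^sub>R f x + t *\<^sub>R f y"
      using assms
      by (simp add: f[of \<sigma>] closed_simplex_def scaleR_add_left sum.distrib scaleR_sum_right)
  qed
  show "f (realization_vertex v) = p v" for v
    by (subst f[of "{v}"]) (auto simp: realization_vertex_def)
qed

lemma affine_on_simplices_unique:
  fixes f g :: "('a \<Rightarrow> real) \<Rightarrow> 'b::real_vector"
  assumes fin: "\<And>\<sigma>. \<sigma> \<in> K \<Longrightarrow> finite \<sigma>"
    and down: "\<And>\<sigma> \<tau>. \<sigma> \<in> K \<Longrightarrow> \<tau> \<subseteq> \<sigma> \<Longrightarrow> \<tau> \<noteq> {} \<Longrightarrow> \<tau> \<in> K"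
    and f: "affine_on_simplices K f" and g: "affine_on_simplices K g"
    and eq: "\<And>v. v \<in> \<Union>K \<Longrightarrow> f (realization_vertex v) = g (realization_vertex v)"
    and x: "x \<in> topspace (geometric_realization K)"
  shows "f x = g x"
proof -
  have "\<forall>x\<in>closed_simplex \<sigma>. f x = g x" if "finite \<sigma>" "\<sigma> \<in> K" for \<sigma>
    using that
  proof (induction \<sigma> rule: finite_induct)
    case empty
    then show ?case by (simp add: closed_simplex_def)
  next
    case (insert a \<sigma>)
    show ?case
    proof
      fix x assume x: "x \<in> closed_simplex (insert a \<sigma>)"
      have sum: "x a + (\<Sum>v\<in>\<sigma>. x v) = 1" and nonneg: "\<And>v. 0 \<le> x v"
        and zero: "\<And>v. v \<noteq> a \<Longrightarrow> v \<notin> \<sigma> \<Longrightarrow> x v = 0"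
        using x insert.hyps by (auto simp: closed_simplex_def)
      have a: "realization_vertex a \<in> closed_simplex (insert a \<sigma>)"
        using insert.hyps by (auto simp: closed_simplex_def realization_vertex_def)
      have le: "x a \<le> 1"
        using sum nonneg sum_nonneg[of \<sigma> x] by simp
      show "f x = g x"
      proof (cases "x a = 1")
        case True
        then have "(\<Sum>v\<in>\<sigma>. x v) = 0" using sum by simp
        then have "x v = 0" if "v \<in> \<sigma>" for v
          using that nonneg insert.hyps by (simp add: sum_nonneg_eq_0_iff)
        then have "x = realization_vertex a"
          using True zero by (auto simp: realization_vertex_def fun_eq_iff)
        then show ?thesis using eq insert.prems by blast
      next
        case False
        with le have lt: "x a < 1" by simp
        define y where "y v = (if v = a then 0 else x v / (1 - x a))" for v
        have "(\<Sum>v\<in>\<sigma>. y v) = (\<Sum>v\<in>\<sigma>. x v / (1 - x a))"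
          using insert.hyps by (intro sum.cong) (auto simp: y_def)
        also have "\<dots> = 1"
          using sum lt by (simp flip: sum_divide_distrib add: field_simps)
        finally have y: "y \<in> closed_simplex \<sigma>"
          using nonneg zero lt insert.hyps by (auto simp: closed_simplex_def y_def)
        then have "\<sigma> \<noteq> {}" by (auto simp: closed_simplex_def)
        then have fgy: "f y = g y"
          using insert.IH insert.prems down[of "insert a \<sigma>" \<sigma>] y by blast
        have y': "y \<in> closed_simplex (insert a \<sigma>)"
          using y insert.hyps by (auto simp: closed_simplex_def)
        have xeq: "x = (\<lambda>v. (1 - x a) * y v + x a * realization_vertex a v)"
          using lt by (auto simp: y_def realization_vertex_def fun_eq_iff)
        have h: "h x = (1 - x a) *\<^sub>R h y + x a *\<^sub>R h (realization_vertex a)"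
          if "affine_on_simplices K h" for h :: "('a \<Rightarrow> real) \<Rightarrow> 'b"
        proof -
          have "h (\<lambda>v. (1 - x a) * y v + x a * realization_vertex a v)
              = (1 - x a) *\<^sub>R h y + x a *\<^sub>R h (realization_vertex a)"
            using that[unfolded affine_on_simplices_def, rule_format, OF insert.prems(1) y' a, of "x a"]
              nonneg[of a] le by simp
          with arg_cong[OF xeq, of h] show ?thesis by (rule trans)
        qed
        have "f (realization_vertex a) = g (realization_vertex a)"
          using eq insert.prems by blast
        then show ?thesis
          using h[OF f] h[OF g] fgy by simp
      qed
    qed
  qed
  then show ?thesis
    using x fin by (auto simp: topspace_geometric_realization)
qed

text \<open>For finite complexes the coherent topology is the Euclidean subspace topology.\<close>

lemma geometric_realization_finite:
  assumes "finite K" "\<And>\<sigma>. \<sigma> \<in> K \<Longrightarrow> finite \<sigma>"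
  shows "geometric_realization K = subtopology (powertop_real UNIV) (\<Union>\<sigma>\<in>K. closed_simplex \<sigma>)"
    (is "_ = ?T")
proof -
  let ?X = "\<Union>\<sigma>\<in>K. closed_simplex \<sigma>"
  have topspace_T: "topspace ?T = ?X"
    by (simp add: topspace_product_topology)
  have sub: "subtopology ?T (closed_simplex \<sigma>)
      = subtopology (powertop_real UNIV) (closed_simplex \<sigma>)" if "\<sigma> \<in> K" for \<sigma>
    using that by (simp add: subtopology_subtopology Int_absorb1 SUP_upper)
  have closed: "closedin ?T (closed_simplex \<sigma>)" if "\<sigma> \<in> K" for \<sigma>
  proof -
    let ?P = "powertop_real (UNIV :: 'a set)"
    have proj: "continuous_map ?P euclideanreal (\<lambda>x. x v)" for v
      by (rule continuous_map_product_projection) simp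
    have 1: "closedin ?P {x. 0 \<le> x v}" for v
      using closedin_continuous_map_preimage[OF proj, of "{0..}" v] by simp
    have 2: "closedin ?P {x. x v = 0}" for v
      using closedin_continuous_map_preimage[OF proj, of "{0}" v] by simp
    have "continuous_map ?P euclideanreal (\<lambda>x. \<Sum>v\<in>\<sigma>. x v)"
      using assms that proj by (intro continuous_map_sum) auto
    then have 3: "closedin ?P {x. (\<Sum>v\<in>\<sigma>. x v) = 1}"
      using closedin_continuous_map_preimage[of ?P euclideanreal _ "{1}"] by force
    have "closed_simplex \<sigma> = \<Inter>(insert {x. (\<Sum>v\<in>\<sigma>. x v) = 1}
            (range (\<lambda>v. {x. 0 \<le> x v}) \<union> (\<lambda>v. {x. x v = 0}) ` (-\<sigma>)))"
      by (auto simp: closed_simplex_def)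
    moreover have "closedin ?P \<dots>"
      using 1 2 3 by (intro closedin_Inter) auto
    ultimately show ?thesis
      using that by (intro closedin_subset_topspace) auto
  qed
  have "openin ?T U" if U: "realization_openin K U" for U
  proof -
    have "closedin ?T (closed_simplex \<sigma> - U)" if "\<sigma> \<in> K" for \<sigma>
    proof -
      let ?F = "subtopology (powertop_real UNIV) (closed_simplex \<sigma>)"
      have "openin ?F (U \<inter> closed_simplex \<sigma>)"
        using U that by (simp add: realization_openin_def)
      then have "closedin ?F (topspace ?F - U \<inter> closed_simplex \<sigma>)"
        by blast
      moreover have "topspace ?F - U \<inter> closed_simplex \<sigma> = closed_simplex \<sigma> - U"
        by (auto simp: topspace_product_topology)
      ultimately have "closedin (subtopology ?T (closed_simplex \<sigma>)) (closed_simplex \<sigma> - U)"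
        by (simp only: sub[OF that])
      then show ?thesis
        using closed[OF that] by (rule closedin_trans_full)
    qed
    then have "closedin ?T (\<Union>\<sigma>\<in>K. closed_simplex \<sigma> - U)"
      using assms by (intro closedin_Union) auto
    moreover have "?X - (\<Union>\<sigma>\<in>K. closed_simplex \<sigma> - U) = U"
      using U unfolding realization_openin_def by blast
    ultimately show ?thesis
      using openin_diff[OF openin_topspace, of ?T "\<Union>\<sigma>\<in>K. closed_simplex \<sigma> - U"]
      by (simp only: topspace_T)
  qed
  moreover have "realization_openin K U" if U: "openin ?T U" for U
    unfolding realization_openin_def
  proof (intro conjI ballI)
    show "U \<subseteq> ?X"
      using openin_subset[OF U] by (simp only: topspace_T)
    show "openin (subtopology (powertop_real UNIV) (closed_simplex \<sigma>)) (U \<inter> closed_simplex \<sigma>)"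
      if "\<sigma> \<in> K" for \<sigma>
      using openin_subtopology_Int[OF U, of "closed_simplex \<sigma>"] by (simp only: sub[OF that])
  qed
  ultimately show ?thesis
    unfolding topology_eq openin_geometric_realization by blast
qed

end

theory Submission
  imports Defs
begin

text \<open>
  Let \<open>Q\<close> be the set of functions \<open>h : [n] \<rightarrow> [0,1]\<close> with maximum \<open>1\<close> whose support is a simplex of
  the nerve. Rescaling identifies \<open>Q\<close> with the realization of the nerve, and sending \<open>h\<close> to the
  family \<open>J \<mapsto> \<bar>{t \<in> (0,1]. {h \<ge> t} = J}\<bar>\<close> of its level set weights identifies \<open>Q\<close> with the
  realization of the barycentric subdivision. In these coordinates a homotopy inverse of \<open>\<Gamma>\<close> is
  \<open>x \<mapsto> (max 0 (1 - d(x, C\<^sub>i) / \<delta>(x)))\<^sub>i\<close>, where \<open>\<delta>(x)\<close> is the minimum of \<open>1\<close> and, over the non-simplices \<open>J\<close>,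
  of \<open>max {d(x, C\<^sub>i). i \<in> J}\<close>: the value is \<open>1\<close> exactly for \<open>x \<in> C\<^sub>i\<close>, and by the choice of \<open>\<delta>\<close>
  the support is a simplex. All level sets of the image of \<open>x\<close> contain each \<open>i\<close> with \<open>x \<in> C\<^sub>i\<close>, so
  \<open>x\<close> and its image under the composition lie in a common convex set \<open>C\<^sub>i\<close>. Conversely, if \<open>k\<close> is the
  image of \<open>h \<in> Q\<close> under the other composition, then \<open>k = 1\<close> wherever \<open>h = 1\<close>, so \<open>h\<close> and \<open>k\<close> can
  both be deformed linearly within \<open>Q\<close> to \<open>min h k\<close>.
\<close>

section \<open>Continuity and homotopies in function spaces\<close>

text \<open>The inserted constant keeps the set non-empty, so the induction can start at
  \<open>A = {}\<close> and each step is a binary \<open>max\<close>.\<close>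

lemma continuous_on_Max_insert:
  fixes f :: "'i \<Rightarrow> 'a::topological_space \<Rightarrow> real"
  assumes "finite A" "\<And>i. i \<in> A \<Longrightarrow> continuous_on S (f i)"
  shows "continuous_on S (\<lambda>x. Max (insert c ((\<lambda>i. f i x) ` A)))"
  using assms
proof (induction A rule: finite_induct)
  case (insert a A)
  have "Max (insert c ((\<lambda>i. f i x) ` insert a A)) = max (f a x) (Max (insert c ((\<lambda>i. f i x) ` A)))" for x
    using insert.hyps by (simp add: insert_commute del: Max_insert flip: Max_insert)
  then show ?case
    using insert by (auto intro!: continuous_on_max)
qed simp

lemma continuous_on_Min_insert:
  fixes f :: "'i \<Rightarrow> 'a::topological_space \<Rightarrow> real"
  assumes "finite A" "\<And>i. i \<in> A \<Longrightarrow> continuous_on S (f i)"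
  shows "continuous_on S (\<lambda>x. Min (insert c ((\<lambda>i. f i x) ` A)))"
  using assms
proof (induction A rule: finite_induct)
  case (insert a A)
  have "Min (insert c ((\<lambda>i. f i x) ` insert a A)) = min (f a x) (Min (insert c ((\<lambda>i. f i x) ` A)))" for x
    using insert.hyps by (simp add: insert_commute del: Min_insert flip: Min_insert)
  then show ?case
    using insert by (auto intro!: continuous_on_min)
qed simp

lemma continuous_on_coordinate:
  "continuous_on S (\<lambda>x. x i :: 'b::topological_space)"
  by (rule continuous_on_subset[OF continuous_on_product_coordinates]) simp

text \<open>The straight-line homotopy, checked one coordinate at a time in the product topology.
  Only the segments from \<open>u x\<close> to \<open>v x\<close> must stay in \<open>T\<close>,
  which need not be convex.\<close>

lemma homotopic_with_linear_fun:
  fixes u v :: "'a::topological_space \<Rightarrow> 'i \<Rightarrow> real"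
  assumes u: "continuous_on S u" and v: "continuous_on S v"
    and T: "\<And>x t. x \<in> S \<Longrightarrow> t \<in> {0..1} \<Longrightarrow> (\<lambda>i. (1 - t) * u x i + t * v x i) \<in> T"
  shows "homotopic_with_canon (\<lambda>x. True) S T u v"
proof -
  let ?h = "\<lambda>z i. (1 - fst z) * u (snd z) i + fst z * v (snd z) i"
  have snd: "continuous_on ({0..1::real} \<times> S) (\<lambda>z. w (snd z) i)" if "continuous_on S w"
    for w :: "'a \<Rightarrow> 'i \<Rightarrow> real" and i
    by (rule continuous_on_compose2[OF continuous_on_product_then_coordinatewise[OF that]])
      (auto intro: continuous_on_snd continuous_on_id)
  have "continuous_on ({0..1} \<times> S) ?h"
    by (intro continuous_on_coordinatewise_then_product continuous_on_add continuous_on_mult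
        continuous_on_diff continuous_on_const continuous_on_fst continuous_on_id snd u v)
  moreover have "?h \<in> {0..1} \<times> S \<rightarrow> T"
    using T by auto
  ultimately have "continuous_map (prod_topology (top_of_set {0..1}) (top_of_set S)) (top_of_set T) ?h"
    by simp
  then show ?thesis
    unfolding homotopic_with_def by (intro exI[of _ ?h]) simp
qed

section \<open>Cubical coordinates on the realization of a finite complex\<close>

definition sup_realization :: "'v set set \<Rightarrow> ('v \<Rightarrow> real) set" where
  "sup_realization K = {h. (\<forall>v. 0 \<le> h v \<and> h v \<le> 1) \<and> {v. h v \<noteq> 0} \<in> K \<and> (\<exists>v. h v = 1)}"

text \<open>Measuring a set of thresholds makes non-negativity and additivity immediate. Threshold
  \<open>0\<close> is left out because for non-negative \<open>h\<close> its superlevel set is the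
  whole vertex type.\<close>

definition level_weight :: "('v \<Rightarrow> real) \<Rightarrow> 'v set \<Rightarrow> real" where
  "level_weight h J = measure lborel {t \<in> {0<..1}. {v. t \<le> h v} = J}"

text \<open>The inverse of \<open>level_weight\<close>: when levels of lengths \<open>y J\<close>
  are stacked, a vertex reaches the total length of the levels that contain it.\<close>

definition height :: "'v set set \<Rightarrow> ('v set \<Rightarrow> real) \<Rightarrow> 'v \<Rightarrow> real" where
  "height K y v = (\<Sum>J | J \<in> K \<and> v \<in> J. y J)"

lemma level_weight_nonneg: "0 \<le> level_weight h J"
  by (simp add: level_weight_def)

lemma level_weight_nonzeroD:
  assumes "level_weight h J \<noteq> 0"
  obtains t where "0 < t" "t \<le> 1" "J = {v. t \<le> h v}"
proof -
  have "{t \<in> {0<..1}. {v. t \<le> h v} = J} \<noteq> {}"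
    using assms unfolding level_weight_def by (metis measure_empty)
  then show ?thesis
    using that by auto
qed

text \<open>A threshold cuts out exactly \<open>J\<close> when it is at most every value on
  \<open>J\<close> and above every value off \<open>J\<close>. The inserted \<open>1\<close> and
  \<open>0\<close> encode the range of \<open>t\<close>; vertices outside \<open>V\<close> drop out
  because \<open>h\<close> vanishes there and \<open>t\<close> is positive.\<close>

lemma level_interval:
  assumes "finite V" "J \<subseteq> V" "\<And>v. v \<notin> V \<Longrightarrow> h v = 0"
  shows "{t \<in> {0<..1}. {v. t \<le> h v} = J} = {Max (insert 0 (h ` (V - J)))<..Min (insert 1 (h ` J))}"
proof -
  have J: "finite J" using assms finite_subset by blast
  have level: "{v. t \<le> h v} = J \<longleftrightarrow> (\<forall>v\<in>J. t \<le> h v) \<and> (\<forall>v\<in>V - J. h v < t)" if "0 < t" for t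
  proof
    show "{v. t \<le> h v} = J" if *: "(\<forall>v\<in>J. t \<le> h v) \<and> (\<forall>v\<in>V - J. h v < t)"
    proof
      show "{v. t \<le> h v} \<subseteq> J"
      proof
        fix v assume "v \<in> {v. t \<le> h v}"
        then have "v \<in> V" "\<not> h v < t" using assms(3)[of v] \<open>0 < t\<close> by force+
        then show "v \<in> J" using * by blast
      qed
    qed (use * in blast)
  qed auto
  show ?thesis
  proof (rule set_eqI)
    fix t
    show "t \<in> {t \<in> {0<..1}. {v. t \<le> h v} = J}
        \<longleftrightarrow> t \<in> {Max (insert 0 (h ` (V - J)))<..Min (insert 1 (h ` J))}"
      using level[of t] J assms(1) by (cases "0 < t") (simp_all, blast)
  qed
qed

text \<open>The outer \<open>max 0\<close> covers an empty interval. Unlike the measure, this closed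
  form is visibly continuous in \<open>h\<close>.\<close>

lemma level_weight_eq:
  assumes "finite V" "J \<subseteq> V" "\<And>v. v \<notin> V \<Longrightarrow> h v = 0"
  shows "level_weight h J = max 0 (Min (insert 1 (h ` J)) - Max (insert 0 (h ` (V - J))))"
proof -
  have "{t \<in> {0<..1}. {v. t \<le> h v} = J} = {Max (insert 0 (h ` (V - J)))<..Min (insert 1 (h ` J))}"
    using assms by (rule level_interval)
  then show ?thesis
    by (simp only: level_weight_def) (simp add: max_def)
qed

text \<open>Each threshold in \<open>(0,1]\<close> has exactly one superlevel set, so the sets being
  measured partition an interval of length 1.\<close>

lemma sum_level_weight:
  assumes "finite V" "\<And>v. v \<notin> V \<Longrightarrow> h v = 0"
  shows "(\<Sum>J\<in>Pow V. level_weight h J) = 1"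
proof -
  let ?L = "\<lambda>J. {t \<in> {0<..1}. {v. t \<le> h v} = J}"
  have interval: "\<exists>a b. ?L J = {a<..b}" if "J \<in> Pow V" for J
    using level_interval[of V J h] assms that by blast
  have "measure lborel (\<Union>J\<in>Pow V. ?L J) = (\<Sum>J\<in>Pow V. measure lborel (?L J))"
  proof (rule measure_finite_Union)
    show "?L ` Pow V \<subseteq> sets lborel"
    proof
      fix A assume "A \<in> ?L ` Pow V"
      then obtain J where J: "J \<in> Pow V" "A = ?L J" by blast
      then obtain a b where "A = {a<..b}" using interval[OF J(1)] by blast
      then show "A \<in> sets lborel" by simp
    qed
    show "emeasure lborel (?L J) \<noteq> \<infinity>" if J: "J \<in> Pow V" for J
    proof -
      obtain a b where "?L J = {a<..b}" using interval[OF J] by blast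
      then show ?thesis by (simp only:) (cases "a \<le> b"; simp)
    qed
    show "disjoint_family_on ?L (Pow V)"
      unfolding disjoint_family_on_def by blast
  qed (use assms(1) in simp)
  then have "(\<Sum>J\<in>Pow V. level_weight h J) = measure lborel (\<Union>J\<in>Pow V. ?L J)"
    by (simp only: level_weight_def)
  also have "(\<Union>J\<in>Pow V. ?L J) = {0<..1}"
  proof -
    have "{v. t \<le> h v} \<in> Pow V" if "0 < t" for t
      using assms(2) that by (metis (mono_tags) PowI mem_Collect_eq not_le subsetI)
    then show ?thesis by auto
  qed
  finally show ?thesis by simp
qed

section \<open>Finite complexes: from height functions to points of the subdivision\<close>

locale finite_complex =
  fixes K :: "'v set set"
  assumes finite_K: "finite K"
    and finite_simplex: "J \<in> K \<Longrightarrow> finite J"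
    and simplex_nonempty: "J \<in> K \<Longrightarrow> J \<noteq> {}"
    and face: "J \<in> K \<Longrightarrow> J' \<subseteq> J \<Longrightarrow> J' \<noteq> {} \<Longrightarrow> J' \<in> K"
begin

lemma finite_vertices: "finite (\<Union>K)"
  using finite_K finite_simplex by blast

lemma sup_realization_zero: "h \<in> sup_realization K \<Longrightarrow> v \<notin> \<Union>K \<Longrightarrow> h v = 0"
  by (auto simp: sup_realization_def)

text \<open>The exact support need not be known: it contains \<open>w\<close> and lies in
  \<open>J\<close>, hence is a non-empty face of \<open>J\<close>.\<close>

lemma sup_realizationI:
  assumes "\<And>v. 0 \<le> h v" "\<And>v. h v \<le> 1" "J \<in> K" "\<And>v. h v \<noteq> 0 \<Longrightarrow> v \<in> J" "h w = 1"
  shows "h \<in> sup_realization K"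
proof -
  have "w \<in> {v. h v \<noteq> 0}" "{v. h v \<noteq> 0} \<subseteq> J"
    using assms by auto
  then have "{v. h v \<noteq> 0} \<in> K"
    using face[OF assms(3)] by blast
  then show ?thesis
    using assms by (auto simp: sup_realization_def)
qed

lemma finite_subdivision: "finite (barycentric_subdivision K)"
  by (rule finite_subset[of _ "Pow K"])
    (auto simp: barycentric_subdivision_def subset.chain_def finite_K)

lemma realization_eq: "geometric_realization K = top_of_set (\<Union>\<sigma>\<in>K. closed_simplex \<sigma>)"
  using geometric_realization_finite[of K] finite_K finite_simplex
  by (simp add: euclidean_product_topology)

lemma subdivision_eq: "geometric_realization (barycentric_subdivision K)
    = top_of_set (\<Union>c\<in>barycentric_subdivision K. closed_simplex c)"
proof -
  have "finite c" if "c \<in> barycentric_subdivision K" for c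
    using that by (simp add: barycentric_subdivision_def)
  then show ?thesis
    using geometric_realization_finite[OF finite_subdivision]
    by (simp only: euclidean_product_topology)
qed

text \<open>A threshold in \<open>(0,1]\<close> keeps every vertex of height 1 and drops those of
  height 0, so the level is a non-empty face of the support.\<close>

lemma level_weight_simplex:
  assumes h: "h \<in> sup_realization K" and J: "level_weight h J \<noteq> 0"
  shows "J \<in> K"
proof -
  obtain t where t: "0 < t" "t \<le> 1" "J = {v. t \<le> h v}"
    using J by (rule level_weight_nonzeroD)
  obtain w where "h w = 1"
    using h by (auto simp: sup_realization_def)
  then have "w \<in> J" "J \<subseteq> {v. h v \<noteq> 0}"
    using t by auto
  then show ?thesis
    using h face[of "{v. h v \<noteq> 0}" J] by (auto simp: sup_realization_def)
qed

lemma sum_level_weight_simplices: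
  assumes h: "h \<in> sup_realization K"
  shows "(\<Sum>J\<in>K. level_weight h J) = 1"
proof -
  have "(\<Sum>J\<in>K. level_weight h J) = (\<Sum>J\<in>Pow (\<Union>K). level_weight h J)"
    using level_weight_simplex[OF h] finite_vertices
    by (intro sum.mono_neutral_left) auto
  then show ?thesis
    using sum_level_weight[OF finite_vertices] sup_realization_zero[OF h] by simp
qed

lemma level_weight_in_subdivision:
  assumes h: "h \<in> sup_realization K"
  shows "level_weight h \<in> (\<Union>c\<in>barycentric_subdivision K. closed_simplex c)"
proof
  let ?c = "{J. level_weight h J \<noteq> 0}"
  have sub: "?c \<subseteq> K"
    using level_weight_simplex[OF h] by auto
  have sum: "(\<Sum>J\<in>?c. level_weight h J) = 1"
    using sum_level_weight_simplices[OF h] sub finite_K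
    by (subst sum.mono_neutral_left[of K]) auto
  then show "level_weight h \<in> closed_simplex ?c"
    by (auto simp: closed_simplex_def level_weight_nonneg)
  \<comment> \<open>Superlevel sets shrink as the threshold grows, so any two are nested.\<close>
  have "J \<subseteq> J' \<or> J' \<subseteq> J" if "J \<in> ?c" "J' \<in> ?c" for J J'
    using that by (force elim!: level_weight_nonzeroD)
  moreover have "?c \<noteq> {}"
    using sum by (metis sum.empty zero_neq_one)
  ultimately show "?c \<in> barycentric_subdivision K"
    using sub finite_subset[OF sub finite_K]
    by (auto simp: barycentric_subdivision_def subset_chain_def)
qed

lemma continuous_on_level_weight: "continuous_on (sup_realization K) level_weight"
proof (rule continuous_on_coordinatewise_then_product)
  fix J
  show "continuous_on (sup_realization K) (\<lambda>h. level_weight h J)"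
  proof (cases "J \<subseteq> \<Union>K")
    case True
    then have "finite J" using finite_vertices finite_subset by blast
    then have "continuous_on (sup_realization K)
        (\<lambda>h. max 0 (Min (insert 1 ((\<lambda>v. h v) ` J)) - Max (insert 0 ((\<lambda>v. h v) ` (\<Union>K - J)))))"
      using finite_vertices
      by (intro continuous_on_max continuous_on_diff continuous_on_const continuous_on_Min_insert
          continuous_on_Max_insert continuous_on_coordinate) auto
    then show ?thesis
      by (rule continuous_on_eq)
        (rule level_weight_eq[OF finite_vertices True sup_realization_zero, symmetric])
  next
    case False
    then have "level_weight h J = 0" if "h \<in> sup_realization K" for h
      using level_weight_simplex[OF that] by blast
    then show ?thesis
      by (simp cong: continuous_on_cong)
  qed
qed

lemma continuous_on_height: "continuous_on S (height K)"
  unfolding height_def[abs_def]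
  by (intro continuous_on_coordinatewise_then_product continuous_on_sum continuous_on_coordinate)

section \<open>From points of the subdivision back to height functions\<close>

context
  fixes y c
  assumes c: "c \<in> barycentric_subdivision K" and y: "y \<in> closed_simplex c"
begin

lemma subdivision_nonneg: "0 \<le> y J"
  using y by (simp add: closed_simplex_def)

lemma subdivision_support: "y J \<noteq> 0 \<Longrightarrow> J \<in> K"
  using y c by (auto simp: closed_simplex_def barycentric_subdivision_def subset_chain_def)

lemma subdivision_comparable: "y J \<noteq> 0 \<Longrightarrow> y J' \<noteq> 0 \<Longrightarrow> J \<subseteq> J' \<or> J' \<subseteq> J"
  using y c unfolding closed_simplex_def barycentric_subdivision_def subset_chain_def by blast

lemma subdivision_sum: "(\<Sum>J\<in>K. y J) = 1"
proof -
  have "(\<Sum>J\<in>c. y J) = (\<Sum>J\<in>K. y J)"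
    using y c finite_K
    by (intro sum.mono_neutral_left)
      (auto simp: closed_simplex_def barycentric_subdivision_def subset_chain_def)
  then show ?thesis
    using y by (simp add: closed_simplex_def)
qed

lemma subdivision_sum_le:
  assumes "A \<subseteq> B" "B \<subseteq> K"
  shows "sum y A \<le> sum y B"
  using assms finite_subset[OF _ finite_K] by (intro sum_mono2) (auto simp: subdivision_nonneg)

lemma height_in_sup_realization: "height K y \<in> sup_realization K"
proof -
  let ?s = "{J. y J \<noteq> 0}"
  have s: "finite ?s" "subset.chain K ?s"
    using subdivision_support subdivision_comparable finite_subset[OF _ finite_K, of ?s]
    by (auto simp: subset_chain_def)
  have ne: "?s \<noteq> {}"
  proof
    assume "?s = {}"
    then have "y J = 0" for J by blast
    then show False using subdivision_sum by simp
  qed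
  \<comment> \<open>The finite chain of simplices with non-zero weight has a largest and a smallest
    member. The largest contains the support of the height function; a vertex of the smallest
    collects all the weight and so has height 1.\<close>
  have top: "\<Union>?s \<in> ?s" and bot: "\<Inter>?s \<in> ?s"
    using Union_in_chain[OF s(1) ne s(2)] Inter_in_chain[OF s(1) ne s(2)] by blast+
  have "\<Inter>?s \<in> K" using bot subdivision_support by blast
  then obtain w where w: "w \<in> \<Inter>?s" using simplex_nonempty by blast
  show ?thesis
  proof (rule sup_realizationI)
    show "0 \<le> height K y v" for v
      by (simp add: height_def sum_nonneg subdivision_nonneg)
    show "height K y v \<le> 1" for v
      unfolding height_def subdivision_sum[symmetric] by (intro subdivision_sum_le) auto
    show "\<Union>?s \<in> K" using top subdivision_support by blast
    show "v \<in> \<Union>?s" if v: "height K y v \<noteq> 0" for v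
    proof -
      obtain J where "J \<in> {J. J \<in> K \<and> v \<in> J}" "y J \<noteq> 0"
        using v unfolding height_def by (rule sum.not_neutral_contains_not_neutral)
      then show ?thesis by blast
    qed
    have "height K y w = (\<Sum>J\<in>K. y J)"
      unfolding height_def using w finite_K by (intro sum.mono_neutral_left) auto
    then show "height K y w = 1"
      by (simp add: subdivision_sum)
  qed
qed

text \<open>For \<open>y J\<close> non-zero, let \<open>A\<close> consist of the simplices strictly
  above \<open>J\<close>. Vertices of \<open>J\<close> have height at least
  \<open>y J + sum y A\<close>, all others at most \<open>sum y A\<close>, so the thresholds with
  level \<open>J\<close> form an interval of length at least \<open>y J\<close>.\<close>

lemma le_level_weight_height: "y J \<le> level_weight (height K y) J"
proof (cases "y J = 0")
  case False
  then have J: "J \<in> K" by (rule subdivision_support)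
  then have JV: "J \<subseteq> \<Union>K" and finJ: "finite J" using finite_simplex by auto
  define A where "A = {J' \<in> K. J \<subset> J'}"
  have A: "finite A" "J \<notin> A" "A \<subseteq> K"
    using finite_K by (auto simp: A_def)
  have "y J + sum y A \<le> Min (insert 1 (height K y ` J))"
  proof -
    have "sum y (insert J A) \<le> height K y v" if "v \<in> J" for v
      unfolding height_def using that J by (intro subdivision_sum_le) (auto simp: A_def)
    moreover have "sum y (insert J A) \<le> 1"
      unfolding subdivision_sum[symmetric] using J A by (intro subdivision_sum_le) auto
    ultimately show ?thesis
      using A finJ by auto
  qed
  moreover have "Max (insert 0 (height K y ` (\<Union>K - J))) \<le> sum y A"
  proof -
    have "height K y v \<le> sum y A" if "v \<notin> J" for v
    proof -
      \<comment> \<open>A simplex of non-zero weight is comparable with \<open>J\<close>; if it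
        contains a vertex outside \<open>J\<close>, it lies strictly above \<open>J\<close>.\<close>
      have "height K y v = sum y {J' \<in> K. v \<in> J' \<and> y J' \<noteq> 0}"
        unfolding height_def using finite_K by (intro sum.mono_neutral_right) auto
      also have "\<dots> \<le> sum y A"
        using that subdivision_comparable[OF False]
        by (intro subdivision_sum_le) (auto simp: A_def)
      finally show ?thesis .
    qed
    moreover have "0 \<le> sum y A"
      by (simp add: sum_nonneg subdivision_nonneg)
    ultimately show ?thesis
      using finite_vertices by auto
  qed
  ultimately show ?thesis
    using level_weight_eq[OF finite_vertices JV sup_realization_zero[OF height_in_sup_realization]]
    by simp
qed (simp add: level_weight_nonneg)

text \<open>Both families of weights sum to 1 over \<open>K\<close>, so the coordinatewise
  inequality forces equality.\<close>

lemma level_weight_height: "level_weight (height K y) = y"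
proof
  fix J
  show "level_weight (height K y) J = y J"
  proof (cases "J \<in> K")
    case True
    have "(\<Sum>J\<in>K. level_weight (height K y) J) = (\<Sum>J\<in>K. y J)"
      by (simp add: sum_level_weight_simplices height_in_sup_realization subdivision_sum)
    then show ?thesis
      using sum_mono_inv[of y K "level_weight (height K y)" J] True finite_K
        le_level_weight_height by metis
  next
    case False
    then show ?thesis
      using level_weight_simplex[OF height_in_sup_realization] subdivision_support by metis
  qed
qed

end

section \<open>Deforming and rescaling height functions\<close>

lemma sup_realization_homotopy:
  fixes u w :: "'a::topological_space \<Rightarrow> 'v \<Rightarrow> real"
  assumes u: "continuous_on S u" "\<And>x. x \<in> S \<Longrightarrow> u x \<in> sup_realization K"
    and w: "continuous_on S w" "\<And>x. x \<in> S \<Longrightarrow> w x \<in> sup_realization K"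
    and one: "\<And>x v. x \<in> S \<Longrightarrow> u x v = 1 \<Longrightarrow> w x v = 1"
  shows "homotopic_with_canon (\<lambda>x. True) S (sup_realization K) u w"
proof -
  \<comment> \<open>The supports of \<open>u x\<close> and \<open>w x\<close> need not lie in a
    common simplex, so the direct segment may leave \<open>sup_realization K\<close>. The minimum
    has its support inside both, and \<open>one\<close> keeps a common vertex of height 1.\<close>
  define m where "m x v = min (u x v) (w x v)" for x v
  have m: "continuous_on S m"
    unfolding m_def
    by (rule continuous_on_coordinatewise_then_product)
      (rule continuous_on_min[OF u(1)[THEN continuous_on_product_then_coordinatewise]
          w(1)[THEN continuous_on_product_then_coordinatewise]])
  have deform: "(\<lambda>v. (1 - t) * h v + t * m x v) \<in> sup_realization K"
    if x: "x \<in> S" and t: "t \<in> {0..1}" and h: "h = u x \<or> h = w x" for x t h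
  proof -
    have hQ: "h \<in> sup_realization K" using u w x h by blast
    obtain v0 where "u x v0 = 1" using u(2)[OF x] by (auto simp: sup_realization_def)
    then have v0: "h v0 = 1" "m x v0 = 1" using one[OF x] h by (auto simp: m_def)
    have bounds: "0 \<le> m x v" "m x v \<le> h v" "0 \<le> h v" "h v \<le> 1" for v
      using u(2)[OF x] w(2)[OF x] h by (auto simp: sup_realization_def m_def)
    show ?thesis
    proof (rule sup_realizationI)
      show "{v. h v \<noteq> 0} \<in> K" using hQ by (simp add: sup_realization_def)
      show "0 \<le> (1 - t) * h v + t * m x v" for v
        using t bounds[of v] by simp
      show "(1 - t) * h v + t * m x v \<le> 1" for v
        using t bounds[of v] by (intro convex_bound_le) auto
      show "(1 - t) * h v0 + t * m x v0 = 1"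
        using v0 by simp
      show "v \<in> {v. h v \<noteq> 0}" if "(1 - t) * h v + t * m x v \<noteq> 0" for v
        using that bounds[of v] by (metis add_0 antisym mem_Collect_eq mult_zero_right)
    qed
  qed
  have "homotopic_with_canon (\<lambda>x. True) S (sup_realization K) u m"
    using u m deform by (intro homotopic_with_linear_fun) auto
  moreover have "homotopic_with_canon (\<lambda>x. True) S (sup_realization K) w m"
    using w m deform by (intro homotopic_with_linear_fun) auto
  ultimately show ?thesis
    using homotopic_with_trans homotopic_with_symD by blast
qed

text \<open>Normalising by the maximum \<open>M\<close> and by the sum \<open>N\<close> undo each
  other because both are homogeneous under positive scaling.\<close>

lemma realization_homeomorphic_sup_realization:
  "geometric_realization K homeomorphic_space top_of_set (sup_realization K)"
proof -
  let ?R = "\<Union>\<sigma>\<in>K. closed_simplex \<sigma>"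
  define M where "M x = Max (insert 0 (x ` \<Union>K))" for x :: "'v \<Rightarrow> real"
  define N where "N x = (\<Sum>v\<in>\<Union>K. x v)" for x :: "'v \<Rightarrow> real"
  have le_M: "x v \<le> M x" if "v \<in> \<Union>K" for x v
    using that finite_vertices by (auto simp: M_def)
  have contM: "continuous_on S M" for S
    unfolding M_def by (intro continuous_on_Max_insert continuous_on_coordinate finite_vertices)
  have contN: "continuous_on S N" for S
    unfolding N_def by (intro continuous_on_sum continuous_on_coordinate)
  have M_attained: "\<exists>v. x v = M x" if "0 < M x" for x
    using Max_in[of "insert 0 (x ` \<Union>K)"] finite_vertices that by (auto simp: M_def)
  have R: "0 < M x" "N x = 1" "\<And>v. 0 \<le> x v" "\<And>v. v \<notin> \<sigma> \<Longrightarrow> x v = 0"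
    if "\<sigma> \<in> K" "x \<in> closed_simplex \<sigma>" for x \<sigma>
  proof -
    show nonneg: "0 \<le> x v" for v using that by (simp add: closed_simplex_def)
    show "x v = 0" if "v \<notin> \<sigma>" for v
      using that \<open>x \<in> closed_simplex \<sigma>\<close> by (simp add: closed_simplex_def)
    have sum: "(\<Sum>v\<in>\<sigma>. x v) = 1" using that by (simp add: closed_simplex_def)
    have "(\<Sum>v\<in>\<sigma>. x v) = N x"
      unfolding N_def using that finite_vertices
      by (intro sum.mono_neutral_left) (auto simp: closed_simplex_def)
    then show "N x = 1" using sum by simp
    obtain v where "v \<in> \<sigma>" "x v \<noteq> 0"
      using sum by (metis sum.neutral zero_neq_one)
    then show "0 < M x"
      using le_M[of v x] nonneg[of v] that(1) by force
  qed
  have Q: "0 < N h" "M h = 1" "\<And>v. 0 \<le> h v" if h: "h \<in> sup_realization K" for h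
  proof -
    show nonneg: "0 \<le> h v" for v using that by (simp add: sup_realization_def)
    obtain w where w: "h w = 1" using h by (auto simp: sup_realization_def)
    then have wK: "w \<in> \<Union>K" using sup_realization_zero[OF that] by force
    show "0 < N h"
      unfolding N_def using finite_vertices wK w nonneg by (intro sum_pos2[of _ w]) auto
    have "M h \<le> 1"
      using that finite_vertices by (auto simp: M_def sup_realization_def)
    then show "M h = 1" using le_M[OF wK, of h] w by simp
  qed
  have "homeomorphic_maps (top_of_set ?R) (top_of_set (sup_realization K))
      (\<lambda>x v. x v / M x) (\<lambda>h v. h v / N h)"
    unfolding homeomorphic_maps_def continuous_map_subtopology_eu topspace_euclidean_subtopology
  proof (intro conjI ballI)
    show "continuous_on ?R (\<lambda>x v. x v / M x)"
      by (intro continuous_on_coordinatewise_then_product continuous_on_divide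
          continuous_on_coordinate contM)
        (use R(1) in force)
    show "continuous_on (sup_realization K) (\<lambda>h v. h v / N h)"
      by (intro continuous_on_coordinatewise_then_product continuous_on_divide
          continuous_on_coordinate contN)
        (use Q(1) in force)
    show "(\<lambda>x v. x v / M x) \<in> ?R \<rightarrow> sup_realization K"
    proof
      fix x assume "x \<in> ?R"
      then obtain \<sigma> where \<sigma>: "\<sigma> \<in> K" "x \<in> closed_simplex \<sigma>" by blast
      note x = R[OF \<sigma>]
      obtain w where "x w = M x" using M_attained x(1) by blast
      moreover have "x v \<le> M x" for v
        using le_M[of v x] x(1) x(4)[of v] \<sigma>(1) by force
      ultimately show "(\<lambda>v. x v / M x) \<in> sup_realization K"
        using x(1) x(3)
        by (intro sup_realizationI[OF _ _ \<sigma>(1), of _ w]) (auto dest: x(4) intro: ccontr)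
    qed
    show "(\<lambda>h v. h v / N h) \<in> sup_realization K \<rightarrow> ?R"
    proof
      fix h assume h: "h \<in> sup_realization K"
      let ?\<sigma> = "{v. h v \<noteq> 0}"
      have \<sigma>: "?\<sigma> \<in> K" using h by (simp add: sup_realization_def)
      have "(\<Sum>v\<in>?\<sigma>. h v) = N h"
        unfolding N_def using \<sigma> finite_vertices by (intro sum.mono_neutral_left) auto
      then have "(\<lambda>v. h v / N h) \<in> closed_simplex ?\<sigma>"
        using Q[OF h] by (simp add: closed_simplex_def flip: sum_divide_distrib)
      then show "(\<lambda>v. h v / N h) \<in> ?R" using \<sigma> by blast
    qed
    show "(\<lambda>v. x v / M x / N (\<lambda>v. x v / M x)) = x" if "x \<in> ?R" for x
    proof -
      have "N (\<lambda>v. x v / M x) = N x / M x" by (simp add: N_def sum_divide_distrib)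
      then show ?thesis using that R(1,2) by (fastforce simp: fun_eq_iff)
    qed
    show "(\<lambda>v. h v / N h / M (\<lambda>v. h v / N h)) = h" if h: "h \<in> sup_realization K" for h
    proof -
      have "M (\<lambda>v. h v / N h) = Max ((\<lambda>r. r / N h) ` insert 0 (h ` \<Union>K))"
        by (simp only: M_def image_insert image_image div_0)
      also have "\<dots> = M h / N h"
        unfolding M_def using Q(1)[OF h] finite_vertices
        by (intro mono_Max_commute[symmetric]) (auto simp: mono_def divide_right_mono)
      finally show ?thesis using Q[OF h] by (simp add: fun_eq_iff)
    qed
  qed
  then show ?thesis
    unfolding realization_eq homeomorphic_space_def by blast
qed

end

section \<open>Finite covers by closed convex sets\<close>

locale closed_convex_cover =
  fixes I :: "'i set" and C :: "'i \<Rightarrow> 'a::real_normed_vector set" and p :: "'i set \<Rightarrow> 'a"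
  assumes finite_I: "finite I"
    and closed_C: "i \<in> I \<Longrightarrow> closed (C i)"
    and convex_C: "i \<in> I \<Longrightarrow> convex (C i)"
    and p: "J \<in> nerve I C \<Longrightarrow> p J \<in> (\<Inter>j\<in>J. C j)"
begin

abbreviation Nrv where "Nrv \<equiv> nerve I C"
abbreviation X where "X \<equiv> \<Union>i\<in>I. C i"
abbreviation Q where "Q \<equiv> sup_realization Nrv"

sublocale finite_complex Nrv
proof
  show "finite Nrv"
    by (rule finite_subset[of _ "Pow I"]) (auto simp: nerve_def finite_I)
  show "J' \<in> Nrv" if J: "J \<in> Nrv" and J': "J' \<subseteq> J" "J' \<noteq> {}" for J J'
  proof -
    have "(\<Inter>j\<in>J. C j) \<subseteq> (\<Inter>j\<in>J'. C j)" using J' by blast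
    then show ?thesis
      using J J' finite_subset[OF J'(1)] unfolding nerve_def by auto
  qed
qed (auto simp: nerve_def)

section \<open>Bump functions of the cover\<close>

text \<open>The case distinction is needed because \<open>infdist x {} = 0\<close>.\<close>

definition cover_dist :: "'i \<Rightarrow> 'a \<Rightarrow> real" where
  "cover_dist i x = (if C i = {} then 1 else infdist x (C i))"

text \<open>The empty set is removed explicitly: it is no simplex, and its inner maximum
  \<open>0\<close> would make the gap \<open>0\<close>. The inserted \<open>1\<close> supplies a
  value when every non-empty subset is a simplex.\<close>

definition gap :: "'a \<Rightarrow> real" where
  "gap x = Min (insert 1 ((\<lambda>J. Max (insert 0 ((\<lambda>i. cover_dist i x) ` J))) ` (Pow I - Nrv - {{}})))"

definition bump :: "'a \<Rightarrow> 'i \<Rightarrow> real" where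
  "bump x i = (if i \<in> I then max 0 (1 - cover_dist i x / gap x) else 0)"

lemma cover_dist_nonneg: "0 \<le> cover_dist i x"
  by (simp add: cover_dist_def infdist_nonneg)

lemma cover_dist_zero_iff: "i \<in> I \<Longrightarrow> cover_dist i x = 0 \<longleftrightarrow> x \<in> C i"
  using in_closed_iff_infdist_zero[OF closed_C] by (auto simp: cover_dist_def)

text \<open>The members of a non-simplex have no common point, so \<open>x\<close> misses one of
  them; that set being closed, its \<open>cover_dist\<close> is positive. Finitely many positive
  maxima have a positive minimum.\<close>

lemma gap_pos: "0 < gap x"
proof -
  have "0 < Max (insert 0 ((\<lambda>i. cover_dist i x) ` J))" if J: "J \<in> Pow I - Nrv - {{}}" for J
  proof -
    have fin: "finite J" using J finite_I finite_subset by blast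
    then have "(\<Inter>j\<in>J. C j) = {}" using J by (auto simp: nerve_def)
    then obtain j where "j \<in> J" "x \<notin> C j" by blast
    then have "0 < cover_dist j x"
      using J cover_dist_zero_iff[of j x] cover_dist_nonneg[of j x] by force
    then show ?thesis
      using fin \<open>j \<in> J\<close> by (subst Max_gr_iff) auto
  qed
  then show ?thesis
    using finite_I by (simp add: gap_def)
qed

lemma continuous_on_bump: "continuous_on S bump"
proof -
  have dist: "continuous_on S (cover_dist i)" for i
    unfolding cover_dist_def by (cases "C i = {}") (auto intro!: continuous_intros)
  have "continuous_on S gap"
    unfolding gap_def using finite_I
    by (intro continuous_on_Min_insert continuous_on_Max_insert dist) (auto intro: finite_subset)
  then have "continuous_on S (\<lambda>x. bump x i)" for i
    unfolding bump_def using gap_pos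
    by (cases "i \<in> I") (auto intro!: continuous_intros dist simp: less_imp_neq[symmetric])
  then show ?thesis
    by (rule continuous_on_coordinatewise_then_product)
qed

lemma bump_eq_one: "i \<in> I \<Longrightarrow> x \<in> C i \<Longrightarrow> bump x i = 1"
  by (simp add: bump_def cover_dist_zero_iff[THEN iffD2])

lemma bump_in_Q:
  assumes "x \<in> X"
  shows "bump x \<in> Q"
proof -
  obtain w where w: "w \<in> I" "x \<in> C w" using assms by blast
  let ?J = "{i. bump x i \<noteq> 0}"
  have JI: "?J \<subseteq> I" by (auto simp: bump_def)
  have "?J \<in> Nrv"
  proof (rule ccontr)
    \<comment> \<open>A support outside the nerve would be one of the sets entering
      \<open>gap\<close>, yet a non-zero bump forces \<open>cover_dist i x < gap x\<close> for every
      member.\<close>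
    assume "?J \<notin> Nrv"
    moreover have "?J \<noteq> {}" using bump_eq_one[OF w] by force
    ultimately have "gap x \<le> Max (insert 0 ((\<lambda>i. cover_dist i x) ` ?J))"
      unfolding gap_def using finite_I JI by (intro Min_le) auto
    moreover have "cover_dist i x < gap x" if "i \<in> ?J" for i
      using that gap_pos[of x] by (auto simp: bump_def max_def field_simps split: if_splits)
    then have "Max (insert 0 ((\<lambda>i. cover_dist i x) ` ?J)) < gap x"
      using gap_pos[of x] finite_subset[OF JI finite_I] by simp
    ultimately show False by simp
  qed
  then show ?thesis
    using bump_eq_one[OF w] gap_pos[of x]
    by (intro sup_realizationI[of _ ?J w]) (auto simp: bump_def cover_dist_nonneg less_imp_le)
qed

section \<open>The affine map and the two homotopies\<close>

definition \<Gamma>\<^sub>0 :: "('i set \<Rightarrow> real) \<Rightarrow> 'a" where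
  "\<Gamma>\<^sub>0 y = (\<Sum>J\<in>Nrv. y J *\<^sub>R p J)"

text \<open>The simplices carrying weight all contain \<open>i\<close>, so their points
  \<open>p J\<close> lie in the convex set \<open>C i\<close>, and \<open>\<Gamma>\<^sub>0 y\<close>
  is a convex combination of them.\<close>

lemma \<Gamma>\<^sub>0_in_C:
  assumes "\<And>J. 0 \<le> y J" "(\<Sum>J\<in>Nrv. y J) = 1" "\<And>J. J \<in> Nrv \<Longrightarrow> y J \<noteq> 0 \<Longrightarrow> i \<in> J" "i \<in> I"
  shows "\<Gamma>\<^sub>0 y \<in> C i"
proof -
  let ?S = "{J \<in> Nrv. y J \<noteq> 0}"
  have "\<Gamma>\<^sub>0 y = (\<Sum>J\<in>?S. y J *\<^sub>R p J)"
    unfolding \<Gamma>\<^sub>0_def using finite_K by (intro sum.mono_neutral_right) auto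
  moreover have "(\<Sum>J\<in>?S. y J) = 1"
    using assms(2) finite_K by (subst sum.mono_neutral_left[of Nrv]) auto
  then have "(\<Sum>J\<in>?S. y J *\<^sub>R p J) \<in> C i"
    using assms finite_K convex_C p by (intro convex_sum) auto
  ultimately show ?thesis by simp
qed

text \<open>A vertex of height 1 survives every threshold in \<open>(0,1]\<close>, so it lies in
  each simplex of non-zero level weight.\<close>

lemma \<Gamma>\<^sub>0_level_weight_in_C:
  assumes h: "h \<in> Q" and i: "h i = 1"
  shows "i \<in> I" "\<Gamma>\<^sub>0 (level_weight h) \<in> C i"
proof -
  show iI: "i \<in> I"
    using sup_realization_zero[OF h] i by (force simp: nerve_def)
  show "\<Gamma>\<^sub>0 (level_weight h) \<in> C i"
    using i by (intro \<Gamma>\<^sub>0_in_C iI level_weight_nonneg sum_level_weight_simplices h)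
      (auto elim!: level_weight_nonzeroD)
qed

lemma continuous_on_\<Gamma>\<^sub>0: "continuous_on S \<Gamma>\<^sub>0"
  unfolding \<Gamma>\<^sub>0_def by (intro continuous_on_sum continuous_on_scaleR continuous_on_const continuous_on_coordinate)

lemma continuous_on_\<Gamma>\<^sub>0_level_weight: "continuous_on Q (\<Gamma>\<^sub>0 \<circ> level_weight)"
  by (intro continuous_on_compose continuous_on_level_weight continuous_on_\<Gamma>\<^sub>0)

lemma \<Gamma>\<^sub>0_level_weight_in_X: "h \<in> Q \<Longrightarrow> \<Gamma>\<^sub>0 (level_weight h) \<in> X"
proof -
  assume h: "h \<in> Q"
  then obtain i where "h i = 1" by (auto simp: sup_realization_def)
  then show ?thesis using \<Gamma>\<^sub>0_level_weight_in_C[OF h] by blast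
qed

lemma homotopic_\<Gamma>\<^sub>0_bump:
  "homotopic_with_canon (\<lambda>x. True) X X (\<Gamma>\<^sub>0 \<circ> level_weight \<circ> bump) id"
proof (rule homotopic_with_linear)
  show "continuous_on X (\<Gamma>\<^sub>0 \<circ> level_weight \<circ> bump)"
    by (intro continuous_on_compose[OF continuous_on_bump]
        continuous_on_subset[OF continuous_on_\<Gamma>\<^sub>0_level_weight]) (auto intro: bump_in_Q)
  show "closed_segment ((\<Gamma>\<^sub>0 \<circ> level_weight \<circ> bump) x) (id x) \<subseteq> X" if x: "x \<in> X" for x
  proof -
    obtain i where i: "i \<in> I" "x \<in> C i" using x by blast
    have "\<Gamma>\<^sub>0 (level_weight (bump x)) \<in> C i"
      using \<Gamma>\<^sub>0_level_weight_in_C(2)[OF bump_in_Q[OF x] bump_eq_one[OF i]] .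
    then have "closed_segment (\<Gamma>\<^sub>0 (level_weight (bump x))) x \<subseteq> C i"
      using i convex_C by (intro closed_segment_subset) auto
    then show ?thesis using i by auto
  qed
qed auto

lemma homotopic_bump_\<Gamma>\<^sub>0:
  "homotopic_with_canon (\<lambda>x. True) Q Q (bump \<circ> (\<Gamma>\<^sub>0 \<circ> level_weight)) id"
\<comment> \<open>Symmetry puts \<open>id\<close> first because the condition on heights 1 is
  directional: \<open>h i = 1\<close> sends the image into \<open>C i\<close>, where the bump is
  1.\<close>
proof (rule homotopic_with_symD, rule sup_realization_homotopy)
  show "continuous_on Q (bump \<circ> (\<Gamma>\<^sub>0 \<circ> level_weight))"
    by (intro continuous_on_compose[OF continuous_on_\<Gamma>\<^sub>0_level_weight] continuous_on_bump)
  show "(bump \<circ> (\<Gamma>\<^sub>0 \<circ> level_weight)) h \<in> Q" if "h \<in> Q" for h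
    using bump_in_Q[OF \<Gamma>\<^sub>0_level_weight_in_X[OF that]] by simp
  show "(bump \<circ> (\<Gamma>\<^sub>0 \<circ> level_weight)) h i = 1" if "h \<in> Q" "id h i = 1" for h i
    using \<Gamma>\<^sub>0_level_weight_in_C[OF that(1)] that(2) bump_eq_one by simp
qed auto

lemma sup_realization_homotopy_equivalent: "top_of_set Q homotopy_equivalent_space top_of_set X"
  unfolding homotopy_equivalent_space_def
proof (intro exI conjI)
  show "continuous_map (top_of_set Q) (top_of_set X) (\<Gamma>\<^sub>0 \<circ> level_weight)"
    unfolding continuous_map_subtopology_eu
    using continuous_on_\<Gamma>\<^sub>0_level_weight \<Gamma>\<^sub>0_level_weight_in_X by simp
  show "continuous_map (top_of_set X) (top_of_set Q) bump"
    unfolding continuous_map_subtopology_eu using continuous_on_bump bump_in_Q by blast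
qed (fact homotopic_bump_\<Gamma>\<^sub>0 homotopic_\<Gamma>\<^sub>0_bump)+

lemma nerve_homotopy_equivalent:
  "geometric_realization Nrv homotopy_equivalent_space top_of_set X"
  using homotopy_eqv_trans[OF homeomorphic_imp_homotopy_equivalent_space
      [OF realization_homeomorphic_sup_realization] sup_realization_homotopy_equivalent] .

text \<open>Maps affine on simplices are fixed by their vertex values, so \<open>\<Gamma>\<close>
  may be replaced by a finite sum that is continuous everywhere. Off the realization the values of
  \<open>\<Gamma>\<close> are arbitrary.\<close>

lemma \<Gamma>\<^sub>0_unique:
  assumes "affine_on_simplices (barycentric_subdivision Nrv) \<Gamma>"
    and "\<And>J. J \<in> Nrv \<Longrightarrow> \<Gamma> (realization_vertex J) = p J"
    and "y \<in> topspace (geometric_realization (barycentric_subdivision Nrv))"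
  shows "\<Gamma> y = \<Gamma>\<^sub>0 y"
proof (rule affine_on_simplices_unique[OF _ _ assms(1) _ _ assms(3)])
  show "affine_on_simplices (barycentric_subdivision Nrv) \<Gamma>\<^sub>0"
    by (simp add: affine_on_simplices_def \<Gamma>\<^sub>0_def scaleR_add_left sum.distrib scaleR_sum_right)
  show "\<tau> \<in> barycentric_subdivision Nrv"
    if "\<sigma> \<in> barycentric_subdivision Nrv" "\<tau> \<subseteq> \<sigma>" "\<tau> \<noteq> {}" for \<sigma> \<tau>
    using that finite_subset[OF that(2)]
    by (auto simp: barycentric_subdivision_def subset_chain_def subset_iff)
  fix J assume "J \<in> \<Union>(barycentric_subdivision Nrv)"
  then have J: "J \<in> Nrv" by (auto simp: barycentric_subdivision_def subset_chain_def)
  have "\<Gamma>\<^sub>0 (realization_vertex J) = (\<Sum>J'\<in>Nrv. if J' = J then p J' else 0)"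
    unfolding \<Gamma>\<^sub>0_def realization_vertex_def by (intro sum.cong) auto
  then show "\<Gamma> (realization_vertex J) = \<Gamma>\<^sub>0 (realization_vertex J)"
    using assms(2) J finite_K by simp
qed (simp add: barycentric_subdivision_def)

text \<open>The homotopy inverse is \<open>level_weight \<circ> bump\<close>;
  \<open>height Nrv\<close> and \<open>level_weight\<close> transport the homotopy on
  \<open>Q\<close> to the subdivision.\<close>

lemma homotopy_equivalence_\<Gamma>:
  assumes aff: "affine_on_simplices (barycentric_subdivision Nrv) \<Gamma>"
    and vert: "\<And>J. J \<in> Nrv \<Longrightarrow> \<Gamma> (realization_vertex J) = p J"
  shows "homotopy_equivalence (geometric_realization (barycentric_subdivision Nrv)) (top_of_set X) \<Gamma>"
proof -
  let ?S = "\<Union>c\<in>barycentric_subdivision Nrv. closed_simplex c"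
  have \<Gamma>: "\<Gamma> y = \<Gamma>\<^sub>0 y" if "y \<in> ?S" for y
    using \<Gamma>\<^sub>0_unique[OF aff vert] that by (simp add: topspace_geometric_realization)
  have height: "height Nrv y \<in> Q" "level_weight (height Nrv y) = y" if "y \<in> ?S" for y
    using that height_in_sup_realization level_weight_height by blast+
  have cont\<Gamma>: "continuous_map (top_of_set ?S) (top_of_set X) \<Gamma>"
    unfolding continuous_map_subtopology_eu
  proof
    show "continuous_on ?S \<Gamma>"
      using continuous_on_\<Gamma>\<^sub>0 by (rule continuous_on_eq) (simp add: \<Gamma>)
    show "\<Gamma> \<in> ?S \<rightarrow> X"
      using \<Gamma>\<^sub>0_level_weight_in_X height \<Gamma> by (metis Pi_I)
  qed
  have cont_height: "continuous_map (top_of_set ?S) (top_of_set Q) (height Nrv)"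
    using height by (simp add: continuous_on_height)
  have cont_lw: "continuous_map (top_of_set Q) (top_of_set ?S) level_weight"
    using level_weight_in_subdivision by (simp add: continuous_on_level_weight)
  have cont_bump: "continuous_map (top_of_set X) (top_of_set Q) bump"
    using bump_in_Q by (simp add: continuous_on_bump)
  have g: "continuous_map (top_of_set X) (top_of_set ?S) (level_weight \<circ> bump)"
    using continuous_map_compose[OF cont_bump cont_lw] .
  have "homotopic_with_canon (\<lambda>x. True) X X (\<Gamma> \<circ> (level_weight \<circ> bump)) (\<Gamma>\<^sub>0 \<circ> level_weight \<circ> bump)"
    using continuous_map_compose[OF g cont\<Gamma>] \<Gamma>[OF level_weight_in_subdivision[OF bump_in_Q]]
    by (intro homotopic_with_equal) auto
  then have 1: "homotopic_with_canon (\<lambda>x. True) X X (\<Gamma> \<circ> (level_weight \<circ> bump)) id"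
    using homotopic_\<Gamma>\<^sub>0_bump homotopic_with_trans by blast
  \<comment> \<open>Inserting \<open>level_weight \<circ> height Nrv\<close>, the identity on
    \<open>?S\<close>, exposes the composite on \<open>Q\<close> already known to be homotopic to
    \<open>id\<close>.\<close>
  have "homotopic_with_canon (\<lambda>x. True) ?S ?S (level_weight \<circ> bump \<circ> \<Gamma>)
      (level_weight \<circ> ((bump \<circ> (\<Gamma>\<^sub>0 \<circ> level_weight)) \<circ> height Nrv))"
    using continuous_map_compose[OF cont\<Gamma> g] height \<Gamma>
    by (intro homotopic_with_equal) auto
  moreover have "homotopic_with_canon (\<lambda>x. True) ?S ?S
      (level_weight \<circ> ((bump \<circ> (\<Gamma>\<^sub>0 \<circ> level_weight)) \<circ> height Nrv)) (level_weight \<circ> (id \<circ> height Nrv))"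
    by (intro homotopic_with_compose_continuous_map_left[OF _ cont_lw]
        homotopic_with_compose_continuous_map_right[OF homotopic_bump_\<Gamma>\<^sub>0 cont_height]) auto
  moreover have "homotopic_with_canon (\<lambda>x. True) ?S ?S (level_weight \<circ> (id \<circ> height Nrv)) id"
    using continuous_map_compose[OF cont_height cont_lw] height
    by (intro homotopic_with_equal) auto
  ultimately have 2: "homotopic_with_canon (\<lambda>x. True) ?S ?S (level_weight \<circ> bump \<circ> \<Gamma>) id"
    using homotopic_with_trans by blast
  show ?thesis
    unfolding homotopy_equivalence_def subdivision_eq
    using cont\<Gamma> g 1 2 by blast
qed

end

theorem theorem3p1:
  fixes C :: "nat \<Rightarrow> (real ^ 'd) set"
    and n :: nat
    and p :: "nat set \<Rightarrow> real ^ 'd"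
  assumes closed: "\<And>i. i \<le> n \<Longrightarrow> closed (C i)"
    and convex: "\<And>i. i \<le> n \<Longrightarrow> convex (C i)"
    and p: "\<And>J. J \<in> nerve {0..n} C \<Longrightarrow> p J \<in> (\<Inter>j\<in>J. C j)"
  shows "(\<forall>\<Gamma> :: (nat set \<Rightarrow> real) \<Rightarrow> real ^ 'd.
            (\<forall>J \<in> nerve {0..n} C. \<Gamma> (realization_vertex J) = p J) \<and>
            affine_on_simplices (barycentric_subdivision (nerve {0..n} C)) \<Gamma> \<longrightarrow>
            homotopy_equivalence
              (geometric_realization (barycentric_subdivision (nerve {0..n} C)))
              (top_of_set (\<Union>i\<in>{0..n}. C i)) \<Gamma>) \<and>
         geometric_realization (nerve {0..n} C) homotopy_equivalent_space
           top_of_set (\<Union>i\<in>{0..n}. C i)"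
proof -
  interpret closed_convex_cover "{0..n}" C p
    using closed convex p by unfold_locales auto
  show ?thesis
    using homotopy_equivalence_\<Gamma> nerve_homotopy_equivalent by blast
qed

end
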